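(* Let $n\ge 1$ and let $T=\begin{bmatrix}T_{11}&T_{12}&\cdots&T_{1n}\\ T_{21}&T_{22}&\cdots&T_{2n}\\ \vdots&\vdots&\vdots&\vdots\\ T_{n1}&T_{n2}&\cdots&T_{nn}\end{bmatrix}$, where $T_{ij}\in\mathcal{B}_A(\mathcal{H})$ for $1\le i,j\le n$. Then $$w_{\mathbb{A}}\left(\begin{bmatrix}T_{11}&O&\cdots&O\\ O&T_{22}&\cdots&O\\ \vdots&\vdots&\vdots&\vdots\\ O&O&\cdots&T_{nn}\end{bmatrix}\right)\le w_{\mathbb{A}}(T).$$
   Context: $\mathcal{H}$ is a complex Hilbert space with inner product $\langle\cdot,\cdot\rangle$, $\mathcal{B}(\mathcal{H})$ is the algebra of bounded linear operators on $\mathcal{H}$, and $A\in\mathcal{B}(\mathcal{H})$ is a positive operator, i.e. $A$ is selfadjoint and $\langle Ax,x\rangle\ge 0$ for all $x$. Put $\langle x,y\rangle_A=\langle Ax,y\rangle$ and $\|x\|_A=\sqrt{\langle x,x\rangle_A}$. $\mathcal{R}(\cdot)$ denotes range, and $\mathcal{B}_A(\mathcal{H})=\{T\in\mathcal{B}(\mathcal{H}):\mathcal{R}(T^*A)\subseteq\mathcal{R}(A)\}$ (the operators admitting an $A$-adjoint, i.e. some $X\in\mathcal{B}(\mathcal{H})$ with $AX=T^*A$). The $A$-numerical radius is $w_A(T)=\sup\{|\langle Tx,x\rangle_A|:x\in\mathcal{H},\ \|x\|_A=1\}$. $\mathbb{A}=\mathrm{diag}(A,\ldots,A)$ is the $n\times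 n$ diagonal operator matrix with all diagonal entries $A$, a positive operator on $\bigoplus_{i=1}^n\mathcal{H}$, and $w_{\mathbb{A}}$ is defined in the same way with $\bigoplus_{i=1}^n\mathcal{H}$ and $\mathbb{A}$ in place of $\mathcal{H}$ and $A$. $O$ is the null operator on $\mathcal{H}$. *)

theory Defs
  imports "HOL-Analysis.Analysis"
begin

section \<open>Complex Hilbert spaces\<close>

text \<open>
  The inner product is linear in the first and conjugate-linear in the second argument.
  The real vector space structure of the superclass is the restriction of the complex one,
  and the norm is the one induced by the inner product.
\<close>

class complex_inner = real_normed_vector +
  fixes scaleC :: "complex \<Rightarrow> 'a \<Rightarrow> 'a"  (infixr \<open>*\<^sub>C\<close> 75)
    and cinner :: "'a \<Rightarrow> 'a \<Rightarrow> complex"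
  assumes scaleC_add_right: "a *\<^sub>C (x + y) = a *\<^sub>C x + a *\<^sub>C y"
    and scaleC_add_left: "(a + b) *\<^sub>C x = a *\<^sub>C x + b *\<^sub>C x"
    and scaleC_scaleC: "a *\<^sub>C b *\<^sub>C x = (a * b) *\<^sub>C x"
    and scaleC_one: "1 *\<^sub>C x = x"
    and scaleR_scaleC: "r *\<^sub>R x = complex_of_real r *\<^sub>C x"
    and cinner_commute: "cinner x y = cnj (cinner y x)"
    and cinner_add_left: "cinner (x + y) z = cinner x z + cinner y z"
    and cinner_scaleC_left: "cinner (a *\<^sub>C x) y = a * cinner x y"
    and cinner_self_nonneg: "cinner x x \<in> \<real>\<^sub>\<ge>\<^sub>0"
    and cinner_eq_zero_iff: "cinner x x = 0 \<longleftrightarrow> x = 0"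
    and norm_eq_sqrt_cinner: "norm x = sqrt (Re (cinner x x))"

class complex_hilbert = complex_inner + complete_space

instantiation complex :: complex_hilbert
begin

definition scaleC_complex_def: "scaleC a (x::complex) = a * x"
definition cinner_complex_def: "cinner (x::complex) y = x * cnj y"

instance
proof
  show "cinner x x \<in> \<real>\<^sub>\<ge>\<^sub>0" for x :: complex
    by (simp add: cinner_complex_def complex_nonneg_Reals_iff)
  show "norm x = sqrt (Re (cinner x x))" for x :: complex
    by (simp add: cinner_complex_def cmod_def power2_eq_square)
qed (simp_all add: scaleC_complex_def cinner_complex_def algebra_simps scaleR_conv_of_real)

end

text \<open>
  The Hilbert direct sum of \<open>CARD('n)\<close> copies of a space is the type \<open>'a ^ 'n\<close>.
  Its library norm is the Euclidean norm of the vector of norms, which is the norm of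
  the inner product defined here.
\<close>

instantiation vec :: (complex_inner, finite) complex_inner
begin

definition scaleC_vec_def: "scaleC a x = (\<chi> i. a *\<^sub>C (x $ i))"
definition cinner_vec_def: "cinner x y = (\<Sum>i\<in>UNIV. cinner (x $ i) (y $ i))"

instance
proof
  fix x y z :: "'a ^ 'b" and a b :: complex and r :: real
  have nn: "0 \<le> Re (cinner u u)" "Im (cinner u u) = 0" for u :: 'a
    using cinner_self_nonneg[of u] by (auto simp: complex_nonneg_Reals_iff)
  show "a *\<^sub>C (x + y) = a *\<^sub>C x + a *\<^sub>C y"
    by (simp add: scaleC_vec_def vec_eq_iff scaleC_add_right)
  show "(a + b) *\<^sub>C x = a *\<^sub>C x + b *\<^sub>C x"
    by (simp add: scaleC_vec_def vec_eq_iff scaleC_add_left)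
  show "a *\<^sub>C b *\<^sub>C x = (a * b) *\<^sub>C x"
    by (simp add: scaleC_vec_def vec_eq_iff scaleC_scaleC)
  show "1 *\<^sub>C x = x"
    by (simp add: scaleC_vec_def vec_eq_iff scaleC_one)
  show "r *\<^sub>R x = complex_of_real r *\<^sub>C x"
    by (simp add: scaleC_vec_def vec_eq_iff scaleR_scaleC)
  show "cinner x y = cnj (cinner y x)"
    unfolding cinner_vec_def cnj_sum by (rule sum.cong[OF refl], rule cinner_commute)
  show "cinner (x + y) z = cinner x z + cinner y z"
    by (simp add: cinner_vec_def cinner_add_left sum.distrib)
  show "cinner (a *\<^sub>C x) y = a * cinner x y"
    by (simp add: cinner_vec_def scaleC_vec_def cinner_scaleC_left sum_distrib_left)
  show "cinner x x \<in> \<real>\<^sub>\<ge>\<^sub>0"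
    by (simp add: cinner_vec_def complex_nonneg_Reals_iff nn sum_nonneg)
  show nx: "norm x = sqrt (Re (cinner x x))"
    by (simp add: cinner_vec_def norm_vec_def L2_set_def norm_eq_sqrt_cinner nn)
  have "Im (cinner x x) = 0" "0 \<le> Re (cinner x x)"
    by (simp_all add: cinner_vec_def nn sum_nonneg)
  then have "cinner x x = 0 \<longleftrightarrow> norm x = 0"
    by (simp add: nx complex_eq_iff)
  then show "cinner x x = 0 \<longleftrightarrow> x = 0" by simp
qed

end

instance vec :: (complex_hilbert, finite) complex_hilbert ..

section \<open>Operators\<close>

definition bounded_clinear :: "('a::complex_inner \<Rightarrow> 'b::complex_inner) \<Rightarrow> bool" where
  "bounded_clinear T \<longleftrightarrow> bounded_linear T \<and> (\<forall>a x. T (a *\<^sub>C x) = a *\<^sub>C T x)"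

text \<open>As for the library's \<open>adjoint\<close>; for bounded \<open>T\<close> such an \<open>S\<close> exists (Riesz) and is unique.\<close>

definition cadjoint :: "('a::complex_hilbert \<Rightarrow> 'a) \<Rightarrow> 'a \<Rightarrow> 'a" where
  "cadjoint T = (SOME S. \<forall>x y. cinner (T x) y = cinner x (S y))"

definition positive_op :: "('a::complex_hilbert \<Rightarrow> 'a) \<Rightarrow> bool" where
  "positive_op A \<longleftrightarrow>
     bounded_clinear A \<and> cadjoint A = A \<and> (\<forall>x. cinner (A x) x \<in> \<real>\<^sub>\<ge>\<^sub>0)"

definition A_inner :: "('a::complex_hilbert \<Rightarrow> 'a) \<Rightarrow> 'a \<Rightarrow> 'a \<Rightarrow> complex" where
  "A_inner A x y = cinner (A x) y"

text \<open>For positive \<open>A\<close> the number \<open>A_inner A x x\<close> is real, so \<open>Re\<close> loses nothing.\<close>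

definition A_seminorm :: "('a::complex_hilbert \<Rightarrow> 'a) \<Rightarrow> 'a \<Rightarrow> real" where
  "A_seminorm A x = sqrt (Re (A_inner A x x))"

definition A_adjointable :: "('a::complex_hilbert \<Rightarrow> 'a) \<Rightarrow> ('a \<Rightarrow> 'a) set" where
  "A_adjointable A = {T. bounded_clinear T \<and> range (cadjoint T \<circ> A) \<subseteq> range A}"

text \<open>
  The supremum is taken in \<open>[0, \<infinity>]\<close>: it is \<open>\<infinity>\<close> if the set of values is unbounded
  and 0 if no vector has seminorm 1, that is, for \<open>A = 0\<close>.
\<close>

definition A_numerical_radius :: "('a::complex_hilbert \<Rightarrow> 'a) \<Rightarrow> ('a \<Rightarrow> 'a) \<Rightarrow> ennreal" where
  "A_numerical_radius A T =
     (SUP x\<in>{x. A_seminorm A x = 1}. ennreal (cmod (A_inner A (T x) x)))"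

definition op_matrix ::
  "('a::complex_hilbert \<Rightarrow> 'a) ^ 'n ^ 'n \<Rightarrow> 'a ^ 'n \<Rightarrow> 'a ^ 'n" where
  "op_matrix T x = (\<chi> i. \<Sum>j\<in>UNIV. (T $ i $ j) (x $ j))"

definition op_diag :: "('a::complex_hilbert \<Rightarrow> 'a) ^ 'n \<Rightarrow> 'a ^ 'n \<Rightarrow> 'a ^ 'n" where
  "op_diag D = op_matrix (\<chi> i j. if i = j then D $ i else (\<lambda>x. 0))"

end

theory Submission
  imports Defs
begin

text \<open>
  Changing the signs of the components of a vector \<open>x\<close> leaves its seminorm unchanged, and it
  multiplies the \<open>(i, j)\<close> term of the double sum
  \<open>\<Sum>i. \<Sum>j. A_inner A (T\<^sub>i\<^sub>j x\<^sub>j) x\<^sub>i\<close>, which is the quadratic form of the full matrix at \<open>x\<close>,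
  by the product \<open>\<epsilon>\<^sub>i \<epsilon>\<^sub>j\<close> of the two signs. Averaged over all sign patterns, this product is 1 for
  \<open>i = j\<close> and 0 otherwise (\<open>sum_pattern_sign_mult\<close>), so the quadratic form of the block diagonal at
  \<open>x\<close> is the average of the values of the quadratic form of the full matrix at the sign changes
  of \<open>x\<close>. Some sign pattern therefore gives a value of at least the same modulus
  (\<open>ex_signs_cmod_trace_le\<close>), and this value is one of those
  over which the supremum for the full matrix is taken.
\<close>

text \<open>
  Encoding a pattern by its set of negative indices makes the patterns a finite type, over
  which sums run over \<open>UNIV\<close>, and turns a sign change into inserting or removing one index.
\<close>

definition pattern_sign :: "'i set \<Rightarrow> 'i \<Rightarrow> real" where
  "pattern_sign S i = (if i \<in> S then -1 else 1)"

lemma pattern_sign_mult_self: "pattern_sign S i * pattern_sign S i = 1"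
  by (simp add: pattern_sign_def)

text \<open>
  The signs are the Rademacher functions, here on the power set with counting measure:
  flipping the sign at \<open>i\<close> alone is an involution on the patterns that negates the
  product \<open>\<epsilon>\<^sub>i \<epsilon>\<^sub>j\<close> whenever \<open>j \<noteq> i\<close>.
\<close>

lemma sum_pattern_sign_mult:
  fixes i j :: "'i::finite"
  shows "(\<Sum>S\<in>UNIV. pattern_sign S i * pattern_sign S j) = (if i = j then 2 ^ CARD('i) else 0)"
proof (cases "i = j")
  case True
  then show ?thesis
    by (simp add: pattern_sign_mult_self card_UNIV_set)
next
  case False
  define flip where "flip S = (if i \<in> S then S - {i} else insert i S)" for S
  have flip_flip: "flip (flip S) = S" for S
    by (auto simp: flip_def)
  have "(\<Sum>S\<in>UNIV. pattern_sign S i * pattern_sign S j)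
      = (\<Sum>S\<in>UNIV. - (pattern_sign S i * pattern_sign S j))"
    using False
    by (intro sum.reindex_bij_witness[of _ flip flip])
      (auto simp: flip_flip, auto simp: flip_def pattern_sign_def)
  then show ?thesis
    using False by (simp add: sum_negf)
qed

text \<open>
  The trace is the average over all sign patterns of the double sums on the right, by
  orthogonality of the signs, and an average is at most the largest of its terms in modulus.
\<close>

lemma ex_signs_cmod_trace_le:
  fixes a :: "'i::finite \<Rightarrow> 'i \<Rightarrow> complex"
  shows "\<exists>S. cmod (\<Sum>i\<in>UNIV. a i i)
    \<le> cmod (\<Sum>i\<in>UNIV. \<Sum>j\<in>UNIV. of_real (pattern_sign S i * pattern_sign S j) * a i j)"
proof (rule ccontr)
  define q where
    "q S = (\<Sum>i\<in>UNIV. \<Sum>j\<in>UNIV. of_real (pattern_sign S i * pattern_sign S j) * a i j)" for S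
  assume "\<not> ?thesis"
  then have less: "cmod (q S) < cmod (\<Sum>i\<in>UNIV. a i i)" for S
    by (auto simp: q_def not_le)
  have "(\<Sum>S\<in>UNIV. q S)
      = (\<Sum>i\<in>UNIV. \<Sum>j\<in>UNIV. \<Sum>S\<in>UNIV. of_real (pattern_sign S i * pattern_sign S j) * a i j)"
    unfolding q_def by (subst sum.swap, intro sum.cong refl, rule sum.swap)
  also have "\<dots> = (\<Sum>i\<in>UNIV. \<Sum>j\<in>UNIV. if i = j then 2 ^ CARD('i) * a i j else 0)"
    by (intro sum.cong refl)
      (simp del: of_real_mult
        add: sum_distrib_right[symmetric] of_real_sum[symmetric] sum_pattern_sign_mult)
  also have "\<dots> = 2 ^ CARD('i) * (\<Sum>i\<in>UNIV. a i i)"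
    by (simp add: sum_distrib_left)
  finally have "2 ^ CARD('i) * cmod (\<Sum>i\<in>UNIV. a i i) = cmod (\<Sum>S\<in>UNIV. q S)"
    by (simp add: norm_mult norm_power)
  also have "\<dots> \<le> (\<Sum>S\<in>UNIV. cmod (q S))"
    by (rule norm_sum)
  also have "\<dots> < (\<Sum>S\<in>(UNIV :: 'i set set). cmod (\<Sum>i\<in>UNIV. a i i))"
    by (intro sum_strict_mono less) auto
  also have "\<dots> = 2 ^ CARD('i) * cmod (\<Sum>i\<in>UNIV. a i i)"
    by (simp add: card_UNIV_set)
  finally show False
    by simp
qed

lemma cinner_scaleR_scaleR: "cinner (r *\<^sub>R x) (s *\<^sub>R y) = of_real (r * s) * cinner x y"
proof -
  have "cinner x (s *\<^sub>R y) = of_real s * cinner x y"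
    by (subst cinner_commute)
      (simp add: scaleR_scaleC cinner_scaleC_left cinner_commute[of x y])
  then show ?thesis
    by (simp add: scaleR_scaleC[of r] cinner_scaleC_left)
qed

lemma cinner_sum_left: "cinner (\<Sum>k\<in>K. f k) y = (\<Sum>k\<in>K. cinner (f k) y)"
proof -
  have "cinner 0 y = 0"
    using cinner_add_left[of 0 0 y] by simp
  then show ?thesis
    by (induction K rule: infinite_finite_induct) (simp_all add: cinner_add_left)
qed

lemma op_diag_nth: "op_diag D x $ i = (D $ i) (x $ i)"
  by (simp add: op_diag_def op_matrix_def if_distribR)

lemma A_inner_op_diag_op_matrix:
  fixes A :: "'h::complex_hilbert \<Rightarrow> 'h" and T :: "('h \<Rightarrow> 'h) ^ 'n ^ 'n"
  assumes "bounded_clinear A"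
  shows "A_inner (op_diag (\<chi> i. A)) (op_matrix T x) y
    = (\<Sum>i\<in>UNIV. \<Sum>j\<in>UNIV. A_inner A ((T $ i $ j) (x $ j)) (y $ i))"
proof -
  have "A (\<Sum>j\<in>J. f j) = (\<Sum>j\<in>J. A (f j))" for J and f :: "'n \<Rightarrow> 'h"
    using assms by (simp add: bounded_clinear_def bounded_linear.linear linear_sum)
  then show ?thesis
    by (simp add: A_inner_def cinner_vec_def op_diag_nth op_matrix_def cinner_sum_left)
qed

lemma A_inner_op_diag:
  "A_inner (op_diag (\<chi> i. A)) x y = (\<Sum>i\<in>UNIV. A_inner A (x $ i) (y $ i))"
  by (simp add: A_inner_def cinner_vec_def op_diag_nth)

text \<open>
  Domination value by value, at vectors of equal seminorm, passes to the suprema whether or not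
  they are finite.
\<close>

lemma ex_dominating_full_matrix_value:
  fixes T :: "('h::complex_hilbert \<Rightarrow> 'h) ^ 'n ^ 'n" and x :: "'h ^ 'n"
  assumes A: "bounded_clinear A" and T: "\<And>i j. bounded_clinear (T $ i $ j)"
  shows "\<exists>y. A_seminorm (op_diag (\<chi> i. A)) y = A_seminorm (op_diag (\<chi> i. A)) x
    \<and> cmod (A_inner (op_diag (\<chi> i. A)) (op_diag (\<chi> i. T $ i $ i) x) x)
      \<le> cmod (A_inner (op_diag (\<chi> i. A)) (op_matrix T y) y)"
proof -
  let ?A = "op_diag (\<chi> i. A) :: 'h ^ 'n \<Rightarrow> 'h ^ 'n"
  define a where "a i j = A_inner A ((T $ i $ j) (x $ j)) (x $ i)" for i j
  obtain S where S: "cmod (\<Sum>i\<in>UNIV. a i i)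
      \<le> cmod (\<Sum>i\<in>UNIV. \<Sum>j\<in>UNIV. of_real (pattern_sign S i * pattern_sign S j) * a i j)"
    using ex_signs_cmod_trace_le[of a] by blast
  define y where "y = (\<chi> i. pattern_sign S i *\<^sub>R (x $ i))"
  have A_scaleR: "A (r *\<^sub>R u) = r *\<^sub>R A u" for r u
    using A by (simp add: bounded_clinear_def bounded_linear.linear linear_scale)
  have T_scaleR: "(T $ i $ j) (r *\<^sub>R u) = r *\<^sub>R (T $ i $ j) u" for i j r u
    using T[of i j] by (simp add: bounded_clinear_def bounded_linear.linear linear_scale)
  have A_inner_scaleR: "A_inner A (r *\<^sub>R u) (s *\<^sub>R v) = of_real (r * s) * A_inner A u v" for r s u v
    by (simp only: A_inner_def A_scaleR cinner_scaleR_scaleR)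
  have "A_inner ?A y y = A_inner ?A x x"
    by (simp add: A_inner_op_diag y_def A_inner_scaleR pattern_sign_mult_self
        del: of_real_mult)
  moreover have "A_inner ?A (op_diag (\<chi> i. T $ i $ i) x) x = (\<Sum>i\<in>UNIV. a i i)"
    by (simp add: A_inner_op_diag op_diag_nth a_def)
  moreover have "A_inner ?A (op_matrix T y) y
      = (\<Sum>i\<in>UNIV. \<Sum>j\<in>UNIV. of_real (pattern_sign S i * pattern_sign S j) * a i j)"
    using A by (simp add: A_inner_op_diag_op_matrix y_def T_scaleR A_inner_scaleR a_def
        mult.commute mult.left_commute)
  ultimately show ?thesis
    using S by (intro exI[of _ y]) (simp add: A_seminorm_def)
qed

theorem theorem3p18:
  fixes A :: "'h::complex_hilbert \<Rightarrow> 'h"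
    and T :: "('h \<Rightarrow> 'h) ^ 'n ^ 'n"
  assumes "positive_op A"
    and "\<And>i j. T $ i $ j \<in> A_adjointable A"
  shows "A_numerical_radius (op_diag (\<chi> i. A)) (op_diag (\<chi> i. T $ i $ i))
       \<le> A_numerical_radius (op_diag (\<chi> i. A)) (op_matrix T)"
  unfolding A_numerical_radius_def
proof (rule SUP_mono)
  fix x :: "'h ^ 'n"
  assume x: "x \<in> {x. A_seminorm (op_diag (\<chi> i. A)) x = 1}"
  have "bounded_clinear A" "\<And>i j. bounded_clinear (T $ i $ j)"
    using assms by (simp_all add: positive_op_def A_adjointable_def)
  from ex_dominating_full_matrix_value[OF this, of x] x
  show "\<exists>y\<in>{x. A_seminorm (op_diag (\<chi> i. A)) x = 1}.
      ennreal (cmod (A_inner (op_diag (\<chi> i. A)) (op_diag (\<chi> i. T $ i $ i) x) x))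
      \<le> ennreal (cmod (A_inner (op_diag (\<chi> i. A)) (op_matrix T y) y))"
    by (auto intro: ennreal_leI)
qed

end
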